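(* Let $S^1=\{e^{i\theta}:\theta\in\mathbb{R}\}$ and let $S^1\times\mathbb{R}^2$ carry the product topology. Define maps $r_1,r_2$ from $(S^1\times\mathbb{R}^2)\times(S^1\times\mathbb{R}^2)$ to itself by $$r_1\big((e^{i\theta_1},x_1,y_1),(e^{i\theta_2},x_2,y_2)\big)=(p_1,q_1),$$ where $$p_1=(e^{i\theta_2},\;x_2\cos\theta_1-y_2\sin\theta_1,\;x_2\sin\theta_1+y_2\cos\theta_1),$$ $$q_1=(e^{i\theta_1},\;x_1\cos\theta_2+y_1\sin\theta_2,\;-x_1\sin\theta_2+y_1\cos\theta_2),$$ and $$r_2\big((e^{i\theta_1},x_1,y_1),(e^{i\theta_2},x_2,y_2)\big)=(p_2,q_2),$$ where $$p_2=(e^{i\theta_2},\;x_2\cos\theta_1+y_2\sin\theta_1,\;-x_2\sin\theta_1+y_2\cos\theta_1),$$ $$q_2=(e^{i\theta_1},\;x_1+x_2-x_2\cos\theta_1-y_2\sin\theta_1,\;y_1+y_2+x_2\sin\theta_1-y_2\cos\theta_1).$$ Then both $(S^1\times\mathbb{R}^2,r_1)$ and $(S^1\times\mathbb{R}^2,r_2)$ are topological biquandles.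
   Context: A biquandle is a set $X$ with a bijective map $r:X\times X\to X\times X$, written $r(a,b)=(b\star a,\,a\ast b)$ (this defines the two binary operations $\star$ and $\ast$ on $X$), satisfying the following axioms. (1) $r$ satisfies the set-theoretic Yang-Baxter equation $(\mathrm{Id}\times r)\circ(r\times\mathrm{Id})\circ(\mathrm{Id}\times r)=(r\times\mathrm{Id})\circ(\mathrm{Id}\times r)\circ(r\times\mathrm{Id})$ on $X\times X\times X$ (here $\circ$ is composition of maps). (2) For every $a\in X$, the maps $\star a:X\to X$, $x\mapsto x\star a$, and $\ast a:X\to X$, $x\mapsto x\ast a$, are both bijective; these induce a unique bijective map $S:X\times X\to X\times X$ such that $S(b\star a,\,a)=(a\ast b,\,b)$ for all $a,b\in X$. (3) $S$ induces a bijection $\tau:X\to X$ on the diagonal, i.e. $S(a,a)=(\tau(a),\tau(a))$ for all $a\in X$, with $\tau$ bijective. A topological biquandle is a topological space $X$ with a biquandle structure such that both operations $\ast,\star:X\times X\to X$ are continuous. *)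

theory Defs
  imports "HOL-Analysis.Analysis"
begin

section \<open>Biquandles\<close>

text \<open>A map \<open>r\<close> on pairs is read as \<open>r (a, b) = (b \<star> a, a \<ast> b)\<close>: the first component is
  the operation on \<open>b\<close> by \<open>a\<close>, hence the swapped arguments of \<open>bq_star\<close>.\<close>

definition bq_star :: "('a \<times> 'a \<Rightarrow> 'a \<times> 'a) \<Rightarrow> 'a \<Rightarrow> 'a \<Rightarrow> 'a" where
  "bq_star r b a = fst (r (a, b))"

definition bq_ast :: "('a \<times> 'a \<Rightarrow> 'a \<times> 'a) \<Rightarrow> 'a \<Rightarrow> 'a \<Rightarrow> 'a" where
  "bq_ast r a b = snd (r (a, b))"

text \<open>The maps \<open>Id \<times> r\<close> and \<open>r \<times> Id\<close>, both on right-nested triples.\<close>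

definition id_times :: "('a \<times> 'a \<Rightarrow> 'a \<times> 'a) \<Rightarrow> 'a \<times> 'a \<times> 'a \<Rightarrow> 'a \<times> 'a \<times> 'a" where
  "id_times r = (\<lambda>(a, b, c). (a, r (b, c)))"

definition times_id :: "('a \<times> 'a \<Rightarrow> 'a \<times> 'a) \<Rightarrow> 'a \<times> 'a \<times> 'a \<Rightarrow> 'a \<times> 'a \<times> 'a" where
  "times_id r = (\<lambda>(a, b, c). (fst (r (a, b)), snd (r (a, b)), c))"

definition sideways_map :: "'a set \<Rightarrow> ('a \<times> 'a \<Rightarrow> 'a \<times> 'a) \<Rightarrow> ('a \<times> 'a \<Rightarrow> 'a \<times> 'a) \<Rightarrow> bool" where
  "sideways_map X r S \<longleftrightarrow>
     bij_betw S (X \<times> X) (X \<times> X) \<and>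
     (\<forall>a\<in>X. \<forall>b\<in>X. S (bq_star r b a, a) = (bq_ast r a b, b))"

text \<open>The map \<open>S\<close> exists and is unique (as a map on \<open>X \<times> X\<close>) as soon as the right
  multiplications are bijective.\<close>

lemma sideways_map_ex1:
  assumes star: "\<And>a. a \<in> X \<Longrightarrow> bij_betw (\<lambda>x. bq_star r x a) X X"
    and ast: "\<And>a. a \<in> X \<Longrightarrow> bij_betw (\<lambda>x. bq_ast r x a) X X"
  shows "\<exists>!S. S \<in> extensional (X \<times> X) \<and> sideways_map X r S"
proof -
  let ?f = "\<lambda>(b, a). (bq_star r b a, a)"
  let ?g = "\<lambda>(b, a). (bq_ast r a b, b)"
  have f: "bij_betw ?f (X \<times> X) (X \<times> X)"
    unfolding bij_betw_def
  proof
    show "inj_on ?f (X \<times> X)"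
      using star by (auto simp: inj_on_def bij_betw_def)
    show "?f ` (X \<times> X) = X \<times> X"
    proof (intro equalityI subsetI)
      fix p assume "p \<in> ?f ` (X \<times> X)"
      then show "p \<in> X \<times> X" using star by (auto dest: bij_betw_apply)
    next
      fix p assume "p \<in> X \<times> X"
      then obtain c a where p: "p = (c, a)" "c \<in> X" "a \<in> X" by auto
      then have "c \<in> (\<lambda>x. bq_star r x a) ` X" using bij_betw_imp_surj_on[OF star] by simp
      then obtain b where "b \<in> X" "c = bq_star r b a" by (rule imageE)
      then show "p \<in> ?f ` (X \<times> X)" using p by force
    qed
  qed
  have g: "bij_betw ?g (X \<times> X) (X \<times> X)"
    unfolding bij_betw_def
  proof
    show "inj_on ?g (X \<times> X)"
      using ast by (auto simp: inj_on_def bij_betw_def)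
    show "?g ` (X \<times> X) = X \<times> X"
    proof (intro equalityI subsetI)
      fix p assume "p \<in> ?g ` (X \<times> X)"
      then show "p \<in> X \<times> X" using ast by (auto dest: bij_betw_apply)
    next
      fix p assume "p \<in> X \<times> X"
      then obtain c b where p: "p = (c, b)" "c \<in> X" "b \<in> X" by auto
      then have "c \<in> (\<lambda>x. bq_ast r x b) ` X" using bij_betw_imp_surj_on[OF ast] by simp
      then obtain a where "a \<in> X" "c = bq_ast r a b" by (rule imageE)
      then show "p \<in> ?g ` (X \<times> X)" using p by force
    qed
  qed
  define h where "h = inv_into (X \<times> X) ?f"
  have h: "bij_betw h (X \<times> X) (X \<times> X)"
    unfolding h_def by (rule bij_betw_inv_into[OF f])
  define S where "S = restrict (?g \<circ> h) (X \<times> X)"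
  have "bij_betw S (X \<times> X) (X \<times> X)"
    using bij_betw_trans[OF h g] unfolding S_def by (simp cong: bij_betw_cong)
  moreover have "S (bq_star r b a, a) = (bq_ast r a b, b)" if "a \<in> X" "b \<in> X" for a b
  proof -
    have "h (?f (b, a)) = (b, a)"
      unfolding h_def using that by (intro bij_betw_inv_into_left[OF f]) auto
    moreover have "?f (b, a) \<in> X \<times> X" using bij_betw_apply[OF f, of "(b, a)"] that by simp
    ultimately show ?thesis unfolding S_def by simp
  qed
  ultimately have S: "S \<in> extensional (X \<times> X) \<and> sideways_map X r S"
    unfolding sideways_map_def S_def by auto
  show ?thesis
  proof (rule ex1I[where a = S])
    show "S \<in> extensional (X \<times> X) \<and> sideways_map X r S" by (rule S)
  next
    fix S' assume S': "S' \<in> extensional (X \<times> X) \<and> sideways_map X r S'"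
    show "S' = S"
    proof (rule extensionalityI)
      show "S' \<in> extensional (X \<times> X)" "S \<in> extensional (X \<times> X)" using S S' by auto
      fix p assume "p \<in> X \<times> X"
      then have "p \<in> ?f ` (X \<times> X)" using f by (simp only: bij_betw_imp_surj_on)
      then obtain b a where "a \<in> X" "b \<in> X" "p = (bq_star r b a, a)" by auto
      moreover have "S' (bq_star r b a, a) = S (bq_star r b a, a)"
        using S S' \<open>a \<in> X\<close> \<open>b \<in> X\<close> by (simp only: sideways_map_def)
      ultimately show "S' p = S p" by (simp only:)
    qed
  qed
qed

locale biquandle =
  fixes X :: "'a set" and r :: "'a \<times> 'a \<Rightarrow> 'a \<times> 'a"
  assumes bij: "bij_betw r (X \<times> X) (X \<times> X)"
    and yang_baxter: "\<And>t. t \<in> X \<times> X \<times> X \<Longrightarrow>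
      (id_times r \<circ> times_id r \<circ> id_times r) t = (times_id r \<circ> id_times r \<circ> times_id r) t"
    and bij_star: "\<And>a. a \<in> X \<Longrightarrow> bij_betw (\<lambda>x. bq_star r x a) X X"
    and bij_ast: "\<And>a. a \<in> X \<Longrightarrow> bij_betw (\<lambda>x. bq_ast r x a) X X"
    and diagonal: "\<exists>S \<tau>. sideways_map X r S \<and> bij_betw \<tau> X X \<and> (\<forall>a\<in>X. S (a, a) = (\<tau> a, \<tau> a))"

definition topological_biquandle :: "'a topology \<Rightarrow> ('a \<times> 'a \<Rightarrow> 'a \<times> 'a) \<Rightarrow> bool" where
  "topological_biquandle T r \<longleftrightarrow>
     biquandle (topspace T) r \<and>
     continuous_map (prod_topology T T) T (\<lambda>(a, b). bq_ast r a b) \<and>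
     continuous_map (prod_topology T T) T (\<lambda>(a, b). bq_star r a b)"

section \<open>Two maps on pairs in the product of the circle and the plane\<close>

definition circle_plane :: "(complex \<times> real \<times> real) topology" where
  "circle_plane = prod_topology (top_of_set (range cis)) euclidean"

text \<open>For \<open>z = cis \<theta>\<close> on the circle, \<open>Re z = cos \<theta>\<close> and \<open>Im z = sin \<theta>\<close>. The formulas in
  terms of angles are \<open>r1_cis\<close> and \<open>r2_cis\<close>; values off the circle play no role.\<close>

definition r1 :: "(complex \<times> real \<times> real) \<times> (complex \<times> real \<times> real)
    \<Rightarrow> (complex \<times> real \<times> real) \<times> (complex \<times> real \<times> real)" where
  "r1 = (\<lambda>((z1, x1, y1), (z2, x2, y2)).
     ((z2, x2 * Re z1 - y2 * Im z1, x2 * Im z1 + y2 * Re z1),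
      (z1, x1 * Re z2 + y1 * Im z2, - x1 * Im z2 + y1 * Re z2)))"

definition r2 :: "(complex \<times> real \<times> real) \<times> (complex \<times> real \<times> real)
    \<Rightarrow> (complex \<times> real \<times> real) \<times> (complex \<times> real \<times> real)" where
  "r2 = (\<lambda>((z1, x1, y1), (z2, x2, y2)).
     ((z2, x2 * Re z1 + y2 * Im z1, - x2 * Im z1 + y2 * Re z1),
      (z1, x1 + x2 - x2 * Re z1 - y2 * Im z1, y1 + y2 + x2 * Im z1 - y2 * Re z1)))"

lemma r1_cis:
  "r1 ((cis \<theta>1, x1, y1), (cis \<theta>2, x2, y2)) =
     ((cis \<theta>2, x2 * cos \<theta>1 - y2 * sin \<theta>1, x2 * sin \<theta>1 + y2 * cos \<theta>1),
      (cis \<theta>1, x1 * cos \<theta>2 + y1 * sin \<theta>2, - x1 * sin \<theta>2 + y1 * cos \<theta>2))"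
  by (simp add: r1_def)

lemma r2_cis:
  "r2 ((cis \<theta>1, x1, y1), (cis \<theta>2, x2, y2)) =
     ((cis \<theta>2, x2 * cos \<theta>1 + y2 * sin \<theta>1, - x2 * sin \<theta>1 + y2 * cos \<theta>1),
      (cis \<theta>1, x1 + x2 - x2 * cos \<theta>1 - y2 * sin \<theta>1,
        y1 + y2 + x2 * sin \<theta>1 - y2 * cos \<theta>1))"
  by (simp add: r2_def)

end

theory Submission
  imports Defs
begin

text \<open>
  Identify the plane with \<open>\<complex>\<close>, so that \<open>cis \<theta>\<close> acts on it by rotation, and write \<open>z\<^sup>*\<close> for
  the conjugate, which is the inverse of \<open>z\<close> on the circle. Then the two maps become
    \<open>r\<^sub>1 ((z, v), (u, w)) = ((u, z w), (z, u\<^sup>* v))\<close> and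
    \<open>r\<^sub>2 ((z, v), (u, w)) = ((u, z\<^sup>* w), (z, v + w - z\<^sup>* w))\<close>.
  Both exchange the circle coordinates and act on the plane by rotations, which are linear and
  commute with each other. Hence each side of the Yang-Baxter equation can be multiplied out, and
  all the inverse maps that the axioms ask for can be written down (\<open>rotation_mult\<close>,
  \<open>rotation_cancel\<close>).

  The sideways map \<open>S\<close> need not be computed: a diagonal point \<open>(a, a)\<close> has the form
  \<open>(b \<star> a, a)\<close> for exactly one \<open>b\<close>, and \<open>S\<close> sends it to \<open>(a \<ast> b, b)\<close>. So the diagonal axiom
  asks for a bijection \<open>\<tau>\<close> with \<open>\<tau> a \<star> a = a\<close> and \<open>a \<ast> \<tau> a = \<tau> a\<close> (\<open>biquandleI\<close>). It is
  \<open>(z, w) \<mapsto> (z, z\<^sup>* w)\<close> for \<open>r\<^sub>1\<close> and \<open>(z, w) \<mapsto> (z, z w)\<close> for \<open>r\<^sub>2\<close>. Continuity is clear, since all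
  coordinates are polynomials in the real coordinates.
\<close>

text \<open>The sideways map on the diagonal is determined by solving \<open>b \<star> a = a\<close> for \<open>b\<close>; the
  solution \<open>b = \<tau> a\<close> is the second component of \<open>S (a, a)\<close>, and \<open>a \<ast> \<tau> a\<close> the first.\<close>

lemma biquandleI:
  assumes bij: "bij_betw r (X \<times> X) (X \<times> X)"
    and yang_baxter: "\<And>t. t \<in> X \<times> X \<times> X \<Longrightarrow>
      (id_times r \<circ> times_id r \<circ> id_times r) t = (times_id r \<circ> id_times r \<circ> times_id r) t"
    and star: "\<And>a. a \<in> X \<Longrightarrow> bij_betw (\<lambda>x. bq_star r x a) X X"
    and ast: "\<And>a. a \<in> X \<Longrightarrow> bij_betw (\<lambda>x. bq_ast r x a) X X"
    and \<tau>: "bij_betw \<tau> X X"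
    and star_\<tau>: "\<And>a. a \<in> X \<Longrightarrow> bq_star r (\<tau> a) a = a"
    and ast_\<tau>: "\<And>a. a \<in> X \<Longrightarrow> bq_ast r a (\<tau> a) = \<tau> a"
  shows "biquandle X r"
proof
  obtain S where S: "sideways_map X r S"
    using sideways_map_ex1[of X r] star ast by blast
  have "S (a, a) = (\<tau> a, \<tau> a)" if "a \<in> X" for a
  proof -
    have "\<tau> a \<in> X" using \<tau> that by (rule bij_betw_apply)
    then have "S (bq_star r (\<tau> a) a, a) = (bq_ast r a (\<tau> a), \<tau> a)"
      using S that by (simp only: sideways_map_def)
    then show ?thesis using that by (simp only: star_\<tau> ast_\<tau>)
  qed
  then show "\<exists>S \<tau>. sideways_map X r S \<and> bij_betw \<tau> X X \<and> (\<forall>a\<in>X. S (a, a) = (\<tau> a, \<tau> a))"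
    using S \<tau> by blast
qed (use assms in auto)

text \<open>Complex multiplication by \<open>z\<close> in real coordinates; a rotation when \<open>z\<close> lies on the circle.\<close>

definition rotation :: "complex \<Rightarrow> real \<times> real \<Rightarrow> real \<times> real" where
  "rotation z w = (fst w * Re z - snd w * Im z, fst w * Im z + snd w * Re z)"

lemma rotation_one: "rotation 1 w = w"
  by (simp add: rotation_def)

lemma rotation_mult: "rotation z (rotation u w) = rotation (z * u) w"
  by (simp add: rotation_def algebra_simps)

lemma rotation_add: "rotation z (v + w) = rotation z v + rotation z w"
  by (simp add: rotation_def algebra_simps)

lemma rotation_diff: "rotation z (v - w) = rotation z v - rotation z w"
  by (simp add: rotation_def algebra_simps)

lemma rotation_cancel:
  assumes "z \<in> range cis"
  shows "rotation z (rotation (cnj z) w) = w" "rotation (cnj z) (rotation z w) = w"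
  using assms by (auto simp: rotation_mult cis_cnj cis_mult rotation_one)

lemma r1_rotation: "r1 ((z, v), (u, w)) = ((u, rotation z w), (z, rotation (cnj u) v))"
  by (cases v; cases w) (simp add: r1_def rotation_def)

lemma r2_rotation:
  "r2 ((z, v), (u, w)) = ((u, rotation (cnj z) w), (z, v + w - rotation (cnj z) w))"
  by (cases v; cases w) (simp add: r2_def rotation_def)

lemmas bq_r1 = bq_star_def[of r1] bq_ast_def[of r1] r1_rotation
lemmas bq_r2 = bq_star_def[of r2] bq_ast_def[of r2] r2_rotation

lemma biquandle_r1: "biquandle (range cis \<times> UNIV) r1"
proof (rule biquandleI[where \<tau> = "\<lambda>(z, w). (z, rotation (cnj z) w)"])
  show "bij_betw r1 ((range cis \<times> UNIV) \<times> (range cis \<times> UNIV))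
      ((range cis \<times> UNIV) \<times> (range cis \<times> UNIV))"
    by (rule bij_betw_byWitness[where
          f' = "\<lambda>((u, w), (z, v)). ((z, rotation u v), (u, rotation (cnj z) w))"])
      (auto simp: r1_rotation rotation_cancel)
next
  fix t :: "(complex \<times> real \<times> real) \<times> (complex \<times> real \<times> real) \<times> (complex \<times> real \<times> real)"
  show "(id_times r1 \<circ> times_id r1 \<circ> id_times r1) t = (times_id r1 \<circ> id_times r1 \<circ> times_id r1) t"
  proof -
    obtain z1 w1 z2 w2 z3 w3 where "t = ((z1, w1), (z2, w2), (z3, w3))"
      by (metis surj_pair)
    then show ?thesis
      by (simp add: id_times_def times_id_def r1_rotation rotation_mult mult.commute)
  qed
next
  fix a :: "complex \<times> real \<times> real"
  assume a: "a \<in> range cis \<times> UNIV"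
  show "bij_betw (\<lambda>x. bq_star r1 x a) (range cis \<times> UNIV) (range cis \<times> UNIV)"
    by (rule bij_betw_byWitness[where f' = "\<lambda>(z, w). (z, rotation (cnj (fst a)) w)"])
      (use a in \<open>auto simp: bq_r1 rotation_cancel\<close>)
  show "bij_betw (\<lambda>x. bq_ast r1 x a) (range cis \<times> UNIV) (range cis \<times> UNIV)"
    by (rule bij_betw_byWitness[where f' = "\<lambda>(z, w). (z, rotation (fst a) w)"])
      (use a in \<open>auto simp: bq_r1 rotation_cancel\<close>)
  show "bq_star r1 (case a of (z, w) \<Rightarrow> (z, rotation (cnj z) w)) a = a"
    using a by (auto simp: bq_r1 rotation_cancel)
  show "bq_ast r1 a (case a of (z, w) \<Rightarrow> (z, rotation (cnj z) w)) =
      (case a of (z, w) \<Rightarrow> (z, rotation (cnj z) w))"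
    by (cases a) (simp add: bq_r1)
next
  show "bij_betw (\<lambda>(z, w). (z, rotation (cnj z) w)) (range cis \<times> UNIV) (range cis \<times> UNIV)"
    by (rule bij_betw_byWitness[where f' = "\<lambda>(z, w). (z, rotation z w)"])
      (auto simp: rotation_cancel)
qed

lemma biquandle_r2: "biquandle (range cis \<times> UNIV) r2"
proof (rule biquandleI[where \<tau> = "\<lambda>(z, w). (z, rotation z w)"])
  \<comment> \<open>In the image, \<open>w\<close> is the rotated second vector, so \<open>rotation z w\<close> recovers the vector itself.\<close>
  show "bij_betw r2 ((range cis \<times> UNIV) \<times> (range cis \<times> UNIV))
      ((range cis \<times> UNIV) \<times> (range cis \<times> UNIV))"
    by (rule bij_betw_byWitness[where
          f' = "\<lambda>((u, w), (z, v)). ((z, v - rotation z w + w), (u, rotation z w))"])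
      (auto simp: r2_rotation rotation_cancel)
next
  fix t :: "(complex \<times> real \<times> real) \<times> (complex \<times> real \<times> real) \<times> (complex \<times> real \<times> real)"
  show "(id_times r2 \<circ> times_id r2 \<circ> id_times r2) t = (times_id r2 \<circ> id_times r2 \<circ> times_id r2) t"
  proof -
    obtain z1 w1 z2 w2 z3 w3 where "t = ((z1, w1), (z2, w2), (z3, w3))"
      by (metis surj_pair)
    then show ?thesis
      by (simp add: id_times_def times_id_def r2_rotation rotation_mult rotation_add
        rotation_diff algebra_simps)
  qed
next
  fix a :: "complex \<times> real \<times> real"
  assume a: "a \<in> range cis \<times> UNIV"
  show "bij_betw (\<lambda>x. bq_star r2 x a) (range cis \<times> UNIV) (range cis \<times> UNIV)"
    by (rule bij_betw_byWitness[where f' = "\<lambda>(z, w). (z, rotation (fst a) w)"])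
      (use a in \<open>auto simp: bq_r2 rotation_cancel\<close>)
  \<comment> \<open>On the plane over each point \<open>z\<close> of the circle, \<open>x \<mapsto> x \<ast> a\<close> is a translation.\<close>
  show "bij_betw (\<lambda>x. bq_ast r2 x a) (range cis \<times> UNIV) (range cis \<times> UNIV)"
    by (rule bij_betw_byWitness[where
          f' = "\<lambda>(z, w). (z, w - snd a + rotation (cnj z) (snd a))"])
      (use a in \<open>auto simp: bq_r2\<close>)
  show "bq_star r2 (case a of (z, w) \<Rightarrow> (z, rotation z w)) a = a"
    using a by (auto simp: bq_r2 rotation_cancel)
  show "bq_ast r2 a (case a of (z, w) \<Rightarrow> (z, rotation z w)) =
      (case a of (z, w) \<Rightarrow> (z, rotation z w))"
    using a by (auto simp: bq_r2 rotation_cancel)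
next
  show "bij_betw (\<lambda>(z, w). (z, rotation z w)) (range cis \<times> UNIV) (range cis \<times> UNIV)"
    by (rule bij_betw_byWitness[where f' = "\<lambda>(z, w). (z, rotation (cnj z) w)"])
      (auto simp: rotation_cancel)
qed

lemma circle_plane_eq: "circle_plane = top_of_set (range cis \<times> UNIV)"
  by (simp add: circle_plane_def prod_topology_subtopology)

text \<open>The operations are the components of \<open>r\<close>, for \<open>\<star>\<close> after exchanging the two arguments.\<close>

lemma topological_biquandle_top_of_setI:
  assumes r: "biquandle X r" and cont: "continuous_on (X \<times> X) r"
  shows "topological_biquandle (top_of_set X) r"
proof -
  have top: "prod_topology (top_of_set X) (top_of_set X) = top_of_set (X \<times> X)"
    by simp
  have "fst (r p) \<in> X" "snd (r p) \<in> X" if "p \<in> X \<times> X" for p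
    using bij_betw_apply[OF biquandle.bij[OF r] that] by (simp_all add: mem_Times_iff)
  moreover have "continuous_on (X \<times> X) (\<lambda>p. r (snd p, fst p))"
    by (rule continuous_on_compose2[OF cont]) (auto intro!: continuous_intros)
  ultimately show ?thesis
    unfolding topological_biquandle_def top bq_ast_def bq_star_def
    using r cont by (auto simp: case_prod_unfold intro!: continuous_intros)
qed

lemma continuous_on_r1: "continuous_on A r1"
  unfolding r1_def case_prod_unfold by (intro continuous_intros)

lemma continuous_on_r2: "continuous_on A r2"
  unfolding r2_def case_prod_unfold by (intro continuous_intros)

theorem corollary3p7:
  "topological_biquandle circle_plane r1 \<and> topological_biquandle circle_plane r2"
  unfolding circle_plane_eq
  by (intro conjI topological_biquandle_top_of_setI biquandle_r1 biquandle_r2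
      continuous_on_r1 continuous_on_r2)

end
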